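(* Let $(\beta_i)_{i=1}^\infty$ be a sequence in $(1,2)$ such that the $\beta_i$-expansion of $1$ terminates for each $i$, and let $(x_i)_{i=1}^\infty$ be a sequence of points in $[0,1]$. Then $$\dim_H\Big(\bigcap_{i=1}^\infty G_{f_{\beta_i}}(x_i)\Big)=1,$$ where $f_\beta\colon x\mapsto \beta x\bmod 1$, $G_{f_\beta}(x)=\Big\{\,y\in[0,1): x\notin\overline{\bigcup_{n=0}^\infty\{f_\beta^n(y)\}}\,\Big\}$, and $\dim_H$ denotes Hausdorff dimension.
   Context: Let $[t]$ denote the integer part of $t$. For $\beta\in(1,2)$ and $x\in[0,1]$, put $d(x,\beta)=\{d_n(x,\beta)\}_{n=0}^\infty\in\{0,1\}^{\mathbb N}$ with $d_n(x,\beta)=[\beta f_\beta^n(x)]$, where $f_\beta(x)=\beta x\bmod 1$ (and $f_\beta^0(x)=x$). The $\beta$-expansion of $1$ terminates if $d(1,\beta)=j_0\dots j_{k-1}0^\infty$ for some $k$, i.e. $d_n(1,\beta)=0$ for all $n\ge k$. *)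

theory Defs
  imports "HOL-Analysis.Analysis"
begin

text \<open>
  Hausdorff measure and dimension in a metric space, through countable covers by bounded
  sets of diameter at most \<open>\<delta>\<close>.
\<close>

text \<open>
  The weight of a covering set is its diameter to the power \<open>s\<close>. Since \<open>0 powr 0 = 0\<close> in HOL,
  the case \<open>s = 0\<close> is separated so that a nonempty set of diameter 0 has weight 1 there;
  the empty set always has weight 0.
\<close>

definition hausdorff_weight :: "real \<Rightarrow> 'a::metric_space set \<Rightarrow> ennreal" where
  "hausdorff_weight s U =
     (if U = {} then 0 else if s = 0 then 1 else ennreal (diameter U powr s))"

text \<open>
  Boundedness of the covering sets is required explicitly because \<^const>\<open>diameter\<close>
  is unspecified on unbounded sets.
\<close>

definition hausdorff_premeasure :: "real \<Rightarrow> real \<Rightarrow> 'a::metric_space set \<Rightarrow> ennreal" where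
  "hausdorff_premeasure s \<delta> A =
     (INF U \<in> {U :: nat \<Rightarrow> 'a set. A \<subseteq> (\<Union>i. U i) \<and> (\<forall>i. bounded (U i) \<and> diameter (U i) \<le> \<delta>)}.
        (\<Sum>i. hausdorff_weight s (U i)))"

definition hausdorff_measure :: "real \<Rightarrow> 'a::metric_space set \<Rightarrow> ennreal" where
  "hausdorff_measure s A = (SUP \<delta> \<in> {0<..}. hausdorff_premeasure s \<delta> A)"

definition hausdorff_dim :: "'a::metric_space set \<Rightarrow> ennreal" where
  "hausdorff_dim A = (INF s \<in> {s. 0 \<le> s \<and> hausdorff_measure s A = 0}. ennreal s)"

definition beta_map :: "real \<Rightarrow> real \<Rightarrow> real" where
  "beta_map \<beta> x = frac (\<beta> * x)"

definition beta_digit :: "real \<Rightarrow> real \<Rightarrow> nat \<Rightarrow> int" where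
  "beta_digit x \<beta> n = \<lfloor>\<beta> * (beta_map \<beta> ^^ n) x\<rfloor>"

definition beta_expansion_of_1_terminates :: "real \<Rightarrow> bool" where
  "beta_expansion_of_1_terminates \<beta> \<longleftrightarrow> (\<exists>k. \<forall>n\<ge>k. beta_digit 1 \<beta> n = 0)"

text \<open>
  The set \<open>G\<^sub>f(x)\<close> of points of \<open>[0,1)\<close> whose forward orbit under \<open>f\<close> does not accumulate at or hit \<open>x\<close>.
  For a map preserving \<open>[0,1]\<close> the closure in \<open>\<real>\<close> agrees with the closure in \<open>[0,1]\<close>.
\<close>

definition G :: "(real \<Rightarrow> real) \<Rightarrow> real \<Rightarrow> real set" where
  "G f x = {y \<in> {0..<1}. x \<notin> closure (\<Union>n. {(f ^^ n) y})}"

end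

theory Submission
  imports Defs
begin

text \<open>
  A cover of the intersection is treated on the same footing as the holes that define it. For
  each \<open>i\<close> the holes are the preimages under \<open>f\<^bsup>n\<^esup>\<close> of a small interval around \<open>x\<^sub>i\<close>; if the
  intersection had zero \<open>s\<close>-dimensional measure for some \<open>s < 1\<close>, it would have a cover \<open>U\<close>
  with a small sum of \<open>s\<close>-th powers of diameters. A point avoiding all holes and all sets of
  \<open>U\<close> is found by descending through the \<open>M\<close>-adic subintervals of \<open>[0, 1/2]\<close>: the sum of
  \<open>\<bar>J\<bar>\<^sup>s\<close> over the obstacles \<open>J\<close> that meet the current interval is kept below a fixed
  fraction of the \<open>s\<close>-th power of its length. An obstacle is then shorter than a child of the
  interval, hence meets at most two of the \<open>M\<close> children, so some child inherits at most the
  proportion \<open>2 / M\<close> of the sum, which is much less than \<open>M\<^bsup>-s\<^esup>\<close>. The slack pays for the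
  holes that enter at the new scale.

  For a given \<open>\<beta>\<close> only boundedly many holes of order \<open>n\<close> meet an interval of length at most
  \<open>\<beta>\<^bsup>-n\<^esup>\<close>: the numbers \<open>\<beta>\<^bsup>n\<^esup> y - f\<^bsup>n\<^esup> y\<close>, which index the branches of \<open>f\<^bsup>n\<^esup>\<close>, are
  separated by the least positive value in the orbit of \<open>1\<close>, and termination makes that orbit
  finite.
\<close>

section \<open>Avoiding countably many obstacles\<close>

text \<open>Serves three counts: children met by an obstacle, orders entering at one stage, and
  branch labels on an interval.\<close>

lemma finite_nat_card_le_of_diffs:
  fixes S :: "nat set"
  assumes "\<And>a b. a \<in> S \<Longrightarrow> b \<in> S \<Longrightarrow> a \<le> b \<Longrightarrow> b \<le> a + D"
  shows "finite S" "card S \<le> D + 1"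
proof -
  have *: "finite S \<and> card S \<le> D + 1"
  proof (cases "S = {}")
    case False
    define a where "a = (LEAST a. a \<in> S)"
    have a: "a \<in> S" using False unfolding a_def by (metis LeastI ex_in_conv)
    have "S \<subseteq> {a..a + D}"
      using assms[OF a] by (auto simp: a_def Least_le)
    then show ?thesis
      using card_mono[of "{a..a + D}" S] finite_subset[of S "{a..a + D}"] by auto
  qed auto
  show "finite S" "card S \<le> D + 1" using * by auto
qed

text \<open>
  The obstacle \<open>B j\<close> has diameter at most \<open>l j\<close> and comes into play at stage \<open>t j\<close>, where
  intervals have length \<open>h (t j)\<close>.
\<close>

definition tame_family ::
    "real \<Rightarrow> (nat \<Rightarrow> real) \<Rightarrow> real \<Rightarrow> ('j \<Rightarrow> real set) \<Rightarrow> ('j \<Rightarrow> real) \<Rightarrow> ('j \<Rightarrow> nat) \<Rightarrow> bool" where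
  "tame_family s h \<delta> B l t \<longleftrightarrow>
     (\<forall>j. 0 < l j \<and> (\<forall>a\<in>B j. \<forall>b\<in>B j. \<bar>a - b\<bar> \<le> l j)) \<and>
     (\<forall>m u. (\<integral>\<^sup>+ j. ennreal (l j powr s) * indicator {j. t j = m \<and> B j \<inter> {u..u + h m} \<noteq> {}} j
               \<partial>count_space UNIV) \<le> ennreal (\<delta> * h m powr s))"

text \<open>By Tonelli the sum over pairs splits into the sums of the single families, so the
  budgets \<open>\<delta> i\<close> add up. The cover and the holes of all \<open>\<beta> i\<close>
  can thus be treated as one family.\<close>

lemma tame_family_combine:
  fixes B :: "nat \<Rightarrow> 'j \<Rightarrow> real set"
  assumes tame: "\<And>i. tame_family s h (\<delta> i) (B i) (l i) (t i)"
    and pos: "\<And>i. 0 \<le> \<delta> i" and sums: "\<delta> sums d"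
  shows "tame_family s h d (\<lambda>(i, j). B i j) (\<lambda>(i, j). l i j) (\<lambda>(i, j). t i j)"
  unfolding tame_family_def
proof (intro conjI allI)
  fix m u
  let ?w = "\<lambda>i j. ennreal (l i j powr s) * indicator {j. t i j = m \<and> B i j \<inter> {u..u + h m} \<noteq> {}} j"
  have "(\<integral>\<^sup>+ p. ennreal ((case p of (i, j) \<Rightarrow> l i j) powr s) *
           indicator {p. (case p of (i, j) \<Rightarrow> t i j) = m \<and>
             (case p of (i, j) \<Rightarrow> B i j) \<inter> {u..u + h m} \<noteq> {}} p \<partial>count_space UNIV)
      = (\<integral>\<^sup>+ p. (case p of (i, j) \<Rightarrow> ?w i j) \<partial>count_space UNIV)"
    by (intro nn_integral_cong) (simp add: indicator_def case_prod_beta)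
  also have "\<dots> = (\<integral>\<^sup>+ i. \<integral>\<^sup>+ j. ?w i j \<partial>count_space UNIV \<partial>count_space UNIV)"
    by (simp add: nn_integral_fst_count_space[symmetric])
  also have "\<dots> \<le> (\<integral>\<^sup>+ i. ennreal (\<delta> i * h m powr s) \<partial>count_space UNIV)"
    using tame by (intro nn_integral_mono) (auto simp: tame_family_def)
  also have "\<dots> = (\<Sum>i. ennreal (\<delta> i * h m powr s))"
    by (simp add: nn_integral_count_space_nat)
  also have "\<dots> = ennreal (d * h m powr s)"
    using pos by (intro suminf_ennreal_eq sums_mult2 sums) auto
  finally show "(\<integral>\<^sup>+ p. ennreal ((case p of (i, j) \<Rightarrow> l i j) powr s) *
           indicator {p. (case p of (i, j) \<Rightarrow> t i j) = m \<and>
             (case p of (i, j) \<Rightarrow> B i j) \<inter> {u..u + h m} \<noteq> {}} p \<partial>count_space UNIV)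
      \<le> ennreal (d * h m powr s)" .
qed (use tame in \<open>auto simp: tame_family_def\<close>)

text \<open>Closed children share endpoints, so an index gap of 2 still allows distance exactly
  \<open>g\<close>; the strict bound on \<open>S\<close> excludes it.\<close>

lemma card_children_met_le_2:
  fixes S :: "real set"
  assumes S: "\<And>a b. a \<in> S \<Longrightarrow> b \<in> S \<Longrightarrow> \<bar>a - b\<bar> < g"
  shows "card {k. k < M \<and> S \<inter> {u + real k * g..u + real k * g + g} \<noteq> {}} \<le> 2"
proof -
  have "b \<le> a + 1" if ab: "S \<inter> {u + real a * g..u + real a * g + g} \<noteq> {}"
      "S \<inter> {u + real b * g..u + real b * g + g} \<noteq> {}" for a b :: nat
  proof (rule ccontr)
    assume "\<not> b \<le> a + 1"
    then have ba: "real a + 2 \<le> real b" by linarith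
    obtain x y where x: "x \<in> S" "x \<le> u + real a * g + g" and y: "y \<in> S" "u + real b * g \<le> y"
      using ab by auto
    have g: "0 < g" using S[OF x(1) x(1)] by simp
    have "(real a + 2) * g \<le> real b * g" using ba g by (intro mult_right_mono) auto
    then have "y - x \<ge> g" using x y by (simp add: algebra_simps)
    then show False using S[OF x(1) y(1)] by linarith
  qed
  then show ?thesis 
    using finite_nat_card_le_of_diffs(2)[of "{k. k < M \<and> S \<inter> {u + real k * g..u + real k * g + g} \<noteq> {}}" 1]
    by simp
qed

text \<open>The quantity kept small during the descent. Obstacles with \<open>t j > m\<close> are
  charged only when their own stage is reached.\<close>

definition potential ::
    "real \<Rightarrow> (nat \<Rightarrow> real) \<Rightarrow> ('j \<Rightarrow> real set) \<Rightarrow> ('j \<Rightarrow> real) \<Rightarrow> ('j \<Rightarrow> nat) \<Rightarrow> nat \<Rightarrow> real \<Rightarrow> ennreal" where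
  "potential s h B l t m u =
     (\<integral>\<^sup>+ j. ennreal (l j powr s) * indicator {j. t j \<le> m \<and> B j \<inter> {u..u + h m} \<noteq> {}} j
       \<partial>count_space UNIV)"

lemma weight_le_potential:
  assumes "t j \<le> m" "B j \<inter> {u..u + h m} \<noteq> {}"
  shows "ennreal (l j powr s) \<le> potential s h B l t m u"
proof -
  have "ennreal (l j powr s) = (\<integral>\<^sup>+ i. ennreal (l j powr s) * indicator {j} i \<partial>count_space UNIV)"
    by (subst nn_integral_cmult_indicator) auto
  also have "\<dots> \<le> potential s h B l t m u"
    unfolding potential_def using assms by (intro nn_integral_mono) (auto split: split_indicator)
  finally show ?thesis .
qed

text \<open>The budget \<open>real M powr (-s) / 2\<close> is split in two. Each old obstacle is
  counted for at most two children, so averaging finds a child where the old ones use at most one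
  half; tameness bounds those of stage \<open>Suc m\<close> by the other half.\<close>

lemma tame_family_step:
  fixes M :: nat and h :: "nat \<Rightarrow> real" and \<delta> s :: real and B :: "'j \<Rightarrow> real set"
  assumes tame: "tame_family s h \<delta> B l t"
    and s: "0 < s" and M: "0 < M" "4 * real M powr s \<le> real M"
    and h: "\<And>m. 0 < h m" "\<And>m. h m = real M * h (Suc m)"
    and \<delta>: "\<delta> \<le> real M powr (-s) / 4"
    and small: "potential s h B l t m u \<le> ennreal (real M powr (-s) / 2 * h m powr s)"
  shows "\<exists>k<M. potential s h B l t (Suc m) (u + real k * h (Suc m))
                 \<le> ennreal (real M powr (-s) / 2 * h (Suc m) powr s)"
proof -
  define g where "g = h (Suc m)"
  have g: "0 < g" unfolding g_def by (rule h(1))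
  have hm: "h m = real M * g" unfolding g_def by (rule h(2))
  \<comment> \<open>With this, \<open>small\<close> bounds the potential by half of
    \<open>g powr s\<close>.\<close>
  have hms: "real M powr (-s) * h m powr s = g powr s"
    using M g by (simp add: hm powr_mult powr_minus)
  define old where "old k = (\<integral>\<^sup>+ j. ennreal (l j powr s) *
      indicator {j. t j \<le> m \<and> B j \<inter> {u + real k * g..u + real k * g + g} \<noteq> {}} j \<partial>count_space UNIV)"
    for k :: nat
  have count: "(\<Sum>k<M. indicator {j. t j \<le> m \<and> B j \<inter> {u + real k * g..u + real k * g + g} \<noteq> {}} j)
      \<le> 2 * (indicator {j. t j \<le> m \<and> B j \<inter> {u..u + h m} \<noteq> {}} j :: ennreal)" for j
  proof (cases "t j \<le> m \<and> B j \<inter> {u..u + h m} \<noteq> {}")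
    case True
    \<comment> \<open>A single obstacle weighs no more than the whole potential, hence is shorter
      than a child.\<close>
    then have "ennreal (l j powr s) \<le> potential s h B l t m u" by (simp add: weight_le_potential)
    also have "\<dots> \<le> ennreal (g powr s / 2)" using small hms by (simp add: field_simps)
    finally have "l j powr s \<le> g powr s / 2" by (simp add: ennreal_le_iff)
    also have "\<dots> < g powr s" using g by simp
    finally have "l j < g"
      using g s powr_mono2[of s g "l j"] by (cases "l j < g") (auto simp: not_less)
    then have "\<bar>a - b\<bar> < g" if "a \<in> B j" "b \<in> B j" for a b
      using tame that unfolding tame_family_def by (meson le_less_trans)
    then have c: "card {k. k < M \<and> B j \<inter> {u + real k * g..u + real k * g + g} \<noteq> {}} \<le> 2"
      by (rule card_children_met_le_2)
    have "(\<Sum>k<M. indicator {j. t j \<le> m \<and> B j \<inter> {u + real k * g..u + real k * g + g} \<noteq> {}} j)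
        = (\<Sum>k\<in>{k. k < M \<and> B j \<inter> {u + real k * g..u + real k * g + g} \<noteq> {}}. 1 :: ennreal)"
      using True by (intro sum.mono_neutral_cong_right) (auto split: split_indicator)
    also have "\<dots> \<le> of_nat 2" using c by (simp only: sum_constant mult_1_right of_nat_le_iff)
    finally show ?thesis using True by simp
  next
    case False
    have sub: "{u + real k * g..u + real k * g + g} \<subseteq> {u..u + h m}" if "k < M" for k
    proof -
      have "(real k + 1) * g \<le> real M * g" using that g by (intro mult_right_mono) auto
      moreover have "0 \<le> real k * g" using g by simp
      ultimately show ?thesis by (simp add: hm algebra_simps)
    qed
    have "(\<Sum>k<M. indicator {j. t j \<le> m \<and> B j \<inter> {u + real k * g..u + real k * g + g} \<noteq> {}} j) = (0::ennreal)"
    proof (intro sum.neutral ballI)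
      fix k assume "k \<in> {..<M}"
      then have "j \<notin> {j. t j \<le> m \<and> B j \<inter> {u + real k * g..u + real k * g + g} \<noteq> {}}"
        using False sub[of k] by blast
      then show "indicator {j. t j \<le> m \<and> B j \<inter> {u + real k * g..u + real k * g + g} \<noteq> {}} j = (0::ennreal)"
        by (rule indicator_simps(2))
    qed
    then show ?thesis by simp
  qed
  have "(\<Sum>k<M. old k) = (\<integral>\<^sup>+ j. ennreal (l j powr s) * (\<Sum>k<M.
      indicator {j. t j \<le> m \<and> B j \<inter> {u + real k * g..u + real k * g + g} \<noteq> {}} j) \<partial>count_space UNIV)"
    unfolding old_def sum_distrib_left by (rule nn_integral_sum[symmetric]) simp
  also have "\<dots> \<le> (\<integral>\<^sup>+ j. 2 * (ennreal (l j powr s) *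
      indicator {j. t j \<le> m \<and> B j \<inter> {u..u + h m} \<noteq> {}} j) \<partial>count_space UNIV)"
  proof (intro nn_integral_mono)
    fix j
    show "ennreal (l j powr s) * (\<Sum>k<M.
        indicator {j. t j \<le> m \<and> B j \<inter> {u + real k * g..u + real k * g + g} \<noteq> {}} j)
      \<le> 2 * (ennreal (l j powr s) * indicator {j. t j \<le> m \<and> B j \<inter> {u..u + h m} \<noteq> {}} j)"
      using mult_left_mono[OF count[of j], of "ennreal (l j powr s)"] by (simp add: mult_ac)
  qed
  also have "\<dots> = 2 * potential s h B l t m u" unfolding potential_def by (subst nn_integral_cmult) auto
  also have "\<dots> \<le> 2 * ennreal (g powr s / 2)"
    using small hms by (intro mult_left_mono) (simp_all add: field_simps)
  also have "\<dots> = ennreal (g powr s)"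
    by (subst ennreal_numeral[symmetric], subst ennreal_mult[symmetric]) auto
  finally have sum_old: "(\<Sum>k<M. old k) \<le> ennreal (g powr s)" .
  have ne: "{..<M} \<noteq> {}" using M by auto
  obtain k where k: "k < M" "\<And>k'. k' < M \<Longrightarrow> old k \<le> old k'"
    using arg_min_least[OF finite_lessThan ne, of _ old] arg_min_if_finite(1)[OF finite_lessThan ne, of old]
    by auto
  have "of_nat M * old k \<le> (\<Sum>k<M. old k)"
    using sum_bounded_below[of "{..<M}" "old k" old] k by simp
  then have Mk: "of_nat M * old k \<le> ennreal (g powr s)" using sum_old by order
  \<comment> \<open>The hypothesis \<open>4 * real M powr s \<le> real M\<close> turns the factor
    \<open>1 / real M\<close> from averaging into \<open>real M powr (-s) / 4\<close>.\<close>
  have oldk: "old k \<le> ennreal (real M powr (-s) / 4 * g powr s)"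
  proof (cases "old k")
    case (real r)
    have "ennreal (real M * r) \<le> ennreal (g powr s)"
      using Mk real by (simp add: ennreal_mult ennreal_of_nat_eq_real_of_nat)
    then have "real M * r \<le> g powr s" by (simp add: ennreal_le_iff)
    then have "r \<le> g powr s * (1 / real M)" using M by (simp add: field_simps)
    also have "\<dots> \<le> g powr s * (real M powr (-s) / 4)"
      using M by (intro mult_left_mono) (simp_all add: powr_minus field_simps)
    finally have "r \<le> real M powr (-s) / 4 * g powr s" by (simp add: mult.commute)
    then show ?thesis using real by (simp only: ennreal_leI)
  next
    case top
    then show ?thesis using Mk M by (simp add: ennreal_mult_top top_unique)
  qed
  have "potential s h B l t (Suc m) (u + real k * g) \<le> (\<integral>\<^sup>+ j. ennreal (l j powr s) *
      indicator {j. t j \<le> m \<and> B j \<inter> {u + real k * g..u + real k * g + g} \<noteq> {}} j +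
      ennreal (l j powr s) *
      indicator {j. t j = Suc m \<and> B j \<inter> {u + real k * g..u + real k * g + h (Suc m)} \<noteq> {}} j
      \<partial>count_space UNIV)"
    unfolding potential_def by (intro nn_integral_mono) (auto split: split_indicator simp: g_def)
  also have "\<dots> = old k + (\<integral>\<^sup>+ j. ennreal (l j powr s) *
      indicator {j. t j = Suc m \<and> B j \<inter> {u + real k * g..u + real k * g + h (Suc m)} \<noteq> {}} j
      \<partial>count_space UNIV)"
    unfolding old_def by (subst nn_integral_add) auto
  also have "\<dots> \<le> ennreal (real M powr (-s) / 4 * g powr s) + ennreal (\<delta> * g powr s)"
    using tame oldk by (intro add_mono) (auto simp: tame_family_def g_def)
  also have "\<dots> \<le> ennreal (real M powr (-s) / 4 * g powr s) + ennreal (real M powr (-s) / 4 * g powr s)"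
    using \<delta> by (intro add_mono ennreal_leI mult_right_mono) auto
  also have "\<dots> = ennreal (real M powr (-s) / 2 * g powr s)"
    by (subst ennreal_plus[symmetric]) (auto simp: field_simps)
  finally show ?thesis using k by (auto simp: g_def)
qed

text \<open>The descent yields nested compact intervals with a common point. If that point lay in
  \<open>B j\<close>, then \<open>l j powr s\<close> would be bounded by a fixed multiple of
  \<open>h m powr s\<close> for all large \<open>m\<close>, hence by 0.\<close>

theorem tame_family_avoidance:
  fixes M :: nat and h :: "nat \<Rightarrow> real" and \<delta> s :: real and B :: "'j \<Rightarrow> real set"
  assumes tame: "tame_family s h \<delta> B l t"
    and s: "0 < s" and M: "1 < M" "4 * real M powr s \<le> real M"
    and h: "\<And>m. h m = h0 / real M ^ m" "0 < h0"
    and \<delta>: "\<delta> \<le> real M powr (-s) / 4"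
  obtains y where "y \<in> {0..h0}" "\<And>j. y \<notin> B j"
proof -
  define good where "good = (\<lambda>m u. potential s h B l t m u \<le> ennreal (real M powr (-s) / 2 * h m powr s))"
  have hpos: "0 < h m" for m using h M by simp
  have hSuc: "h m = real M * h (Suc m)" for m using h M by simp
  have step: "\<exists>k<M. good (Suc m) (u + real k * h (Suc m))" if "good m u" for m u
    using tame_family_step[OF tame s _ M(2) hpos hSuc \<delta>, of m u] M(1) that
    unfolding good_def potential_def by auto
  have "potential s h B l t 0 0 \<le> ennreal (\<delta> * h 0 powr s)"
    using tame unfolding tame_family_def potential_def le_zero_eq by blast
  also have "\<dots> \<le> ennreal (real M powr (-s) / 2 * h 0 powr s)"
    using \<delta> powr_ge_zero[of "real M" "-s"] by (intro ennreal_leI mult_right_mono powr_ge_zero) linarith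
  finally have start: "good 0 0" unfolding good_def .
  \<comment> \<open>The conjunct for \<open>m = 0\<close> pins the start of the descent, which
    places the point in \<open>{0..h0}\<close>.\<close>
  have "\<exists>u. \<forall>m. (good m (u m) \<and> (m = 0 \<longrightarrow> u m = 0)) \<and>
      (\<exists>k<M. u (Suc m) = u m + real k * h (Suc m))"
  proof (rule dependent_nat_choice)
    show "\<exists>u. good 0 u \<and> (0 = (0::nat) \<longrightarrow> u = 0)" using start by auto
    fix v n assume "good n v \<and> (n = 0 \<longrightarrow> v = 0)"
    then show "\<exists>w. (good (Suc n) w \<and> (Suc n = 0 \<longrightarrow> w = 0)) \<and> (\<exists>k<M. w = v + real k * h (Suc n))"
      using step by (metis nat.distinct(1))
  qed
  then obtain u where u: "\<And>m. good m (u m)" "u 0 = 0"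
      "\<And>m. \<exists>k<M. u (Suc m) = u m + real k * h (Suc m)" by blast
  define I where "I m = {u m..u m + h m}" for m
  have "I (Suc m) \<subseteq> I m" for m
  proof -
    obtain k where k: "k < M" "u (Suc m) = u m + real k * h (Suc m)" using u(3) by blast
    have "(real k + 1) * h (Suc m) \<le> real M * h (Suc m)"
      using k hpos[of "Suc m"] by (intro mult_right_mono) auto
    moreover have "0 \<le> real k * h (Suc m)" using hpos[of "Suc m"] by simp
    ultimately show ?thesis using k hSuc[of m] by (auto simp: I_def algebra_simps)
  qed
  then have dec: "I n \<subseteq> I m" if "m \<le> n" for m n
    using lift_Suc_antimono_le[of I m n] that by auto
  have "\<Inter> (range I) \<noteq> {}"
    using dec hpos by (intro compact_nest) (auto simp: I_def less_imp_le)
  then obtain y where y: "\<And>m. y \<in> I m" by auto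
  show thesis
  proof
    show "y \<in> {0..h0}" using y[of 0] u(2) h(1)[of 0] by (simp add: I_def)
    fix j
    show "y \<notin> B j"
    proof
      assume yB: "y \<in> B j"
      have "l j powr s \<le> real M powr (-s) / 2 * h m powr s" if "t j \<le> m" for m
      proof -
        have "ennreal (l j powr s) \<le> potential s h B l t m (u m)"
          using yB y[of m] that by (intro weight_le_potential) (auto simp: I_def)
        also have "\<dots> \<le> ennreal (real M powr (-s) / 2 * h m powr s)" using u(1) by (simp add: good_def)
        finally show ?thesis by (simp add: ennreal_le_iff)
      qed
      then have ev: "\<forall>\<^sub>F m in sequentially. l j powr s \<le> real M powr (-s) / 2 * h m powr s"
        by (auto intro: eventually_sequentiallyI)
      have "h = (\<lambda>m. h0 * (1 / real M) ^ m)" by (simp add: h(1) fun_eq_iff power_divide)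
      then have "h \<longlonglongrightarrow> 0"
        using tendsto_mult_right_zero[OF LIMSEQ_realpow_zero[of "1 / real M"], of h0] M by simp
      then have "(\<lambda>m. h m powr s) \<longlonglongrightarrow> 0"
        using hpos s by (auto intro!: tendsto_zero_powrI less_imp_le always_eventually)
      then have "(\<lambda>m. real M powr (-s) / 2 * h m powr s) \<longlonglongrightarrow> 0"
        using tendsto_mult_right_zero by blast
      then have "l j powr s \<le> 0"
        using ev by (rule tendsto_lowerbound) simp
      then show False using tame by (simp add: tame_family_def) (metis less_irrefl powr_eq_0_iff powr_ge_zero order_antisym)
    qed
  qed
qed

section \<open>Preimages under the beta transformation\<close>

text \<open>
  For \<open>0 \<le> v < 1\<close> this is the polynomial \<open>d\<^sub>0 b\<^bsup>n-1\<^esup> + \<dots> + d\<^bsub>n-1\<^esub>\<close> in the first \<open>n\<close> digits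
  of \<open>v\<close>; it identifies the branch of the \<open>n\<close>-th iterate that contains \<open>v\<close>.
\<close>

definition digit_value :: "real \<Rightarrow> nat \<Rightarrow> real \<Rightarrow> real" where
  "digit_value b n v = b ^ n * v - (beta_map b ^^ n) v"

lemma beta_map_bounds: "0 \<le> beta_map b v" "beta_map b v < 1"
  by (simp_all add: beta_map_def frac_lt_1)

lemma beta_map_funpow_bounds:
  assumes "0 \<le> v" "v < 1"
  shows "0 \<le> (beta_map b ^^ n) v" "(beta_map b ^^ n) v < 1"
  using assms by (induction n) (simp_all add: beta_map_bounds)

text \<open>Splits off the first digit rather than the last, to suit inductions that compare
  expansions lexicographically.\<close>

lemma digit_value_Suc:
  "digit_value b (Suc n) v = b ^ n * of_int \<lfloor>b * v\<rfloor> + digit_value b n (beta_map b v)"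
  by (simp add: digit_value_def funpow_Suc_right beta_map_def frac_def algebra_simps del: funpow.simps)

lemma digit_value_nonneg:
  assumes "0 \<le> b" "0 \<le> v"
  shows "0 \<le> digit_value b n v"
  using assms(2)
proof (induction n arbitrary: v)
  case 0
  then show ?case by (simp add: digit_value_def)
next
  case (Suc n)
  then show ?case using assms(1) by (simp add: digit_value_Suc beta_map_bounds)
qed

text \<open>
  Lexicographic comparison with the expansion of a point of the orbit of \<open>1\<close>; at the first
  differing digit the comparison point is reset to \<open>1\<close> itself.
\<close>

lemma digit_value_below_orbit_of_1:
  assumes b1: "1 \<le> b" and gap: "\<And>j. 0 < (beta_map b ^^ j) 1 \<Longrightarrow> c \<le> (beta_map b ^^ j) 1"
    and v: "0 \<le> v" "v < (beta_map b ^^ j) 1"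
  shows "c \<le> b ^ n * (beta_map b ^^ j) 1 - digit_value b n v"
  using v
proof (induction n arbitrary: v j)
  case 0
  then show ?case using gap[of j] by (simp add: digit_value_def)
next
  case (Suc n)
  define w where "w = (beta_map b ^^ j) 1"
  have w: "b * w = of_int \<lfloor>b * w\<rfloor> + (beta_map b ^^ Suc j) 1"
    by (simp add: w_def beta_map_def frac_def)
  have vw: "b * v < b * w" using Suc.prems b1 by (simp add: w_def)
  have "b ^ Suc n * w - digit_value b (Suc n) v = b ^ n * (b * w) - digit_value b (Suc n) v" by simp
  also have "\<dots> = b ^ n * (of_int \<lfloor>b * w\<rfloor> - of_int \<lfloor>b * v\<rfloor>)
      + b ^ n * (beta_map b ^^ Suc j) 1 - digit_value b n (beta_map b v)"
    by (subst w) (simp add: digit_value_Suc algebra_simps del: funpow.simps)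
  finally have eq: "b ^ Suc n * w - digit_value b (Suc n) v = \<dots>" .
  have "\<lfloor>b * v\<rfloor> \<le> \<lfloor>b * w\<rfloor>" using vw by (intro floor_mono) simp
  then consider "\<lfloor>b * v\<rfloor> = \<lfloor>b * w\<rfloor>" | "\<lfloor>b * v\<rfloor> + 1 \<le> \<lfloor>b * w\<rfloor>" by linarith
  then have "c \<le> b ^ Suc n * w - digit_value b (Suc n) v"
  proof cases
    case 1
    then have "beta_map b v < (beta_map b ^^ Suc j) 1"
      using vw w by (simp add: beta_map_def frac_def)
    then show ?thesis using Suc.IH[of "beta_map b v" "Suc j"] 1 unfolding eq
      by (simp add: beta_map_bounds del: funpow.simps)
  next
    case 2
    then have "1 \<le> real_of_int \<lfloor>b * w\<rfloor> - of_int \<lfloor>b * v\<rfloor>" by linarith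
    then have "b ^ n * 1 \<le> b ^ n * (of_int \<lfloor>b * w\<rfloor> - of_int \<lfloor>b * v\<rfloor>)"
      using b1 by (intro mult_left_mono) auto
    moreover have "0 \<le> b ^ n * (beta_map b ^^ Suc j) 1" using b1 by (simp add: beta_map_bounds)
    moreover have "c \<le> b ^ n * 1 - digit_value b n (beta_map b v)"
      using Suc.IH[of "beta_map b v" 0] by (simp add: beta_map_bounds)
    ultimately show ?thesis unfolding eq by linarith
  qed
  then show ?case by (simp add: w_def)
qed

text \<open>Where the digits first differ, with \<open>n\<close> digits left, the larger one gains
  at least \<open>b ^ n\<close>, while the tail of the smaller expansion stays below
  \<open>b ^ n\<close> by at least \<open>c\<close>, by comparison with the expansion of 1.\<close>

lemma digit_value_separated:
  assumes b: "1 \<le> b" and c: "0 < c"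
    and gap: "\<And>j. 0 < (beta_map b ^^ j) 1 \<Longrightarrow> c \<le> (beta_map b ^^ j) 1"
    and v: "0 \<le> v" "0 \<le> w" "digit_value b n v < digit_value b n w"
  shows "c \<le> digit_value b n w - digit_value b n v"
  using v
proof (induction n arbitrary: v w)
  case 0
  then show ?case by (simp add: digit_value_def)
next
  case (Suc n)
  have less: "c \<le> digit_value b (Suc n) z - digit_value b (Suc n) y"
    if "\<lfloor>b * y\<rfloor> < \<lfloor>b * z\<rfloor>" for y z
  proof -
    have "1 \<le> real_of_int \<lfloor>b * z\<rfloor> - of_int \<lfloor>b * y\<rfloor>" using that by linarith
    then have "b ^ n * 1 \<le> b ^ n * (of_int \<lfloor>b * z\<rfloor> - of_int \<lfloor>b * y\<rfloor>)"
      using b by (intro mult_left_mono) auto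
    moreover have "c \<le> b ^ n * 1 - digit_value b n (beta_map b y)"
      using digit_value_below_orbit_of_1[OF _ gap, of "beta_map b y" 0 n] b
      by (simp add: beta_map_bounds)
    moreover have "0 \<le> digit_value b n (beta_map b z)"
      using b by (intro digit_value_nonneg) (auto simp: beta_map_bounds)
    ultimately show ?thesis by (simp add: digit_value_Suc right_diff_distrib)
  qed
  consider "\<lfloor>b * v\<rfloor> = \<lfloor>b * w\<rfloor>" | "\<lfloor>b * v\<rfloor> < \<lfloor>b * w\<rfloor>" | "\<lfloor>b * w\<rfloor> < \<lfloor>b * v\<rfloor>" by linarith
  then show ?case
  proof cases
    case 1
    then show ?thesis
      using Suc.IH[of "beta_map b v" "beta_map b w"] Suc.prems(3)
      by (simp add: digit_value_Suc beta_map_bounds)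
  qed (use less[of v w] less[of w v] Suc.prems c in auto)
qed

text \<open>Once the digits vanish, the map is multiplication by \<open>b\<close>; as the orbit is
  bounded, no positive value can occur from then on. Only finitely many positive values
  remain.\<close>

lemma orbit_of_1_gap:
  assumes b: "1 < b" and terminates: "beta_expansion_of_1_terminates b"
  obtains c where "0 < c" "\<And>j. 0 < (beta_map b ^^ j) 1 \<Longrightarrow> c \<le> (beta_map b ^^ j) 1"
proof -
  obtain k where k: "\<And>n. k \<le> n \<Longrightarrow> beta_digit 1 b n = 0"
    using terminates unfolding beta_expansion_of_1_terminates_def by auto
  define z where "z = (beta_map b ^^ k) 1"
  have z: "(beta_map b ^^ (k + j)) 1 = b ^ j * z" for j
  proof (induction j)
    case (Suc j)
    have "\<lfloor>b * (beta_map b ^^ (k + j)) 1\<rfloor> = 0" using k[of "k + j"] by (simp add: beta_digit_def)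
    then have "beta_map b ((beta_map b ^^ (k + j)) 1) = b * (beta_map b ^^ (k + j)) 1"
      by (simp add: beta_map_def frac_def)
    then show ?case using Suc by simp
  qed (simp add: z_def)
  have le1: "(beta_map b ^^ n) 1 \<le> 1" for n
    by (cases n) (simp_all add: beta_map_bounds less_imp_le)
  have "z \<le> 0"
  proof (rule ccontr)
    assume "\<not> z \<le> 0"
    moreover obtain j where "1 / z < b ^ j" using real_arch_pow[OF b] by blast
    ultimately have "1 < b ^ j * z" by (simp add: field_simps)
    then show False using z[of j] le1[of "k + j"] by simp
  qed
  then have late: "(beta_map b ^^ n) 1 \<le> 0" if "k \<le> n" for n
    using z[of "n - k"] that b by (simp add: mult_nonneg_nonpos)
  \<comment> \<open>The inserted 1 makes \<open>S\<close> nonempty, so that \<open>Min S\<close> is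
    meaningful.\<close>
  define S where "S = insert 1 ((\<lambda>j. (beta_map b ^^ j) 1) ` {..<k} \<inter> {0<..})"
  have S: "finite S" "S \<noteq> {}" by (auto simp: S_def)
  show thesis
  proof
    show "0 < Min S" using S by (auto simp: S_def)
    fix j assume "0 < (beta_map b ^^ j) 1"
    moreover from this have "j < k" using late[of j] by (cases "j < k") auto
    ultimately have "(beta_map b ^^ j) 1 \<in> S" by (auto simp: S_def)
    then show "Min S \<le> (beta_map b ^^ j) 1" using S by simp
  qed
qed

text \<open>A hole of order \<open>n\<close> enters at the stage where \<open>h m\<close> is
  comparable to \<open>1 / b ^ n\<close>. The number of obstacles meeting an interval there has a
  bound independent of the stage and of the radius \<open>c\<close>, so a small \<open>c\<close>
  makes their total weight fit the budget.\<close>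

lemma tame_family_beta:
  fixes M :: nat and h :: "nat \<Rightarrow> real" and b x s \<delta> :: real
  assumes b: "1 < b" and terminates: "beta_expansion_of_1_terminates b"
    and s: "0 < s" and M: "1 < M" and h: "\<And>m. h m = h0 / real M ^ m" "0 < h0" "h0 \<le> 1"
    and \<delta>: "0 < \<delta>"
  obtains c l t and B :: "nat \<times> nat \<Rightarrow> real set" where "0 < c" "tame_family s h \<delta> B l t"
    "\<And>y n. y \<in> {0..<1} \<Longrightarrow> \<bar>(beta_map b ^^ n) y - x\<bar> < c \<Longrightarrow> \<exists>j. y \<in> B j"
proof -
  \<comment> \<open>On \<open>B (n, k)\<close> the floor of \<open>digit_value b n y / c0\<close> is constant, so by separation
    \<open>digit_value b n\<close> itself is constant and \<open>B (n, k)\<close> lies in a single branch.\<close>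
  obtain c0 where c0: "0 < c0" and gap: "\<And>j. 0 < (beta_map b ^^ j) 1 \<Longrightarrow> c0 \<le> (beta_map b ^^ j) 1"
    using orbit_of_1_gap[OF b terminates] by blast
  define q where "q = log (real M) b"
  have q: "0 < q" using b M by (simp add: q_def)
  have bpow: "b ^ n = real M powr (real n * q)" for n
  proof -
    have "b ^ n = (real M powr q) powr real n" using b M by (simp add: q_def powr_realpow)
    then show ?thesis by (simp add: powr_powr mult.commute)
  qed
  \<comment> \<open>\<open>N\<close> bounds the spread of the orders entering at one stage,
    \<open>K\<close> the spread of labels \<open>\<kappa> n y\<close> on an interval of that stage
    (with 1 added for the floor), and \<open>D\<close> the resulting number of obstacles.\<close>
  define N where "N = nat \<lceil>1 / q\<rceil>"
  define K where "K = nat \<lceil>2 / c0\<rceil> + 1"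
  define D where "D = real ((N + 1) * (K + 1))"
  have D: "0 < D" unfolding D_def of_nat_0_less_iff by simp
  \<comment> \<open>The radius \<open>c\<close> will make every obstacle of stage \<open>m\<close>
    at most \<open>e * h m\<close> long, so that each of at most \<open>D\<close> obstacles uses a
    share \<open>\<delta> / D\<close> of the budget.\<close>
  define e where "e = (\<delta> / D) powr (1 / s)"
  have e: "0 < e" "e powr s = \<delta> / D" using \<delta> D s by (simp_all add: e_def powr_powr)
  define c where "c = e * h0 / (2 * real M)"
  have c: "0 < c" using e h M by (simp add: c_def)
  define t :: "nat \<times> nat \<Rightarrow> nat" where "t = (\<lambda>(n, k). nat \<lceil>real n * q\<rceil>)"
  define l :: "nat \<times> nat \<Rightarrow> real" where "l = (\<lambda>(n, k). 2 * c / b ^ n)"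
  define \<kappa> where "\<kappa> n y = nat \<lfloor>digit_value b n y / c0\<rfloor>" for n y
  define B :: "nat \<times> nat \<Rightarrow> real set" where
    "B = (\<lambda>(n, k). {y \<in> {0..<1}. \<bar>(beta_map b ^^ n) y - x\<bar> < c \<and> \<kappa> n y = k})"
  have dv0: "0 \<le> digit_value b n y" if "y \<in> {0..<1}" for n y
    using that b by (intro digit_value_nonneg) auto
  have diam: "\<bar>y - z\<bar> \<le> l (n, k)" if yz: "y \<in> B (n, k)" "z \<in> B (n, k)" for n k y z
  proof -
    have r: "y \<in> {0..<1}" "z \<in> {0..<1}" and near: "\<bar>(beta_map b ^^ n) y - x\<bar> < c"
        "\<bar>(beta_map b ^^ n) z - x\<bar> < c" and "\<kappa> n y = \<kappa> n z"
      using yz by (auto simp: B_def)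
    then have "\<lfloor>digit_value b n y / c0\<rfloor> = \<lfloor>digit_value b n z / c0\<rfloor>"
      using dv0[OF r(1), of n] dv0[OF r(2), of n] c0 by (auto simp: \<kappa>_def eq_nat_nat_iff)
    then have "\<bar>digit_value b n y / c0 - digit_value b n z / c0\<bar> < 1" by linarith
    then have "\<bar>digit_value b n y - digit_value b n z\<bar> < c0"
      using c0 by (simp add: diff_divide_distrib[symmetric] abs_divide)
    then have "digit_value b n y = digit_value b n z"
      using digit_value_separated[of b c0 y z n] digit_value_separated[of b c0 z y n] b c0 gap r
      by (cases "digit_value b n y" "digit_value b n z" rule: linorder_cases) auto
    then have "b ^ n * (y - z) = (beta_map b ^^ n) y - (beta_map b ^^ n) z"
      by (simp add: digit_value_def algebra_simps)
    then have "\<bar>b ^ n * (y - z)\<bar> \<le> 2 * c" using near by linarith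
    then have "b ^ n * \<bar>y - z\<bar> \<le> 2 * c" using b by (simp add: abs_mult)
    then show ?thesis using b by (simp add: l_def field_simps)
  qed
  have count: "finite {j. t j = m \<and> B j \<inter> {u..u + h m} \<noteq> {}} \<and>
      card {j. t j = m \<and> B j \<inter> {u..u + h m} \<noteq> {}} \<le> (N + 1) * (K + 1)" for m u
  proof -
    define NN where "NN = {n. nat \<lceil>real n * q\<rceil> = m}"
    define KK where "KK n = \<kappa> n ` ({0..<1} \<inter> {u..u + h m})" for n
    have ceil: "real n * q \<le> m" "real m - 1 < real n * q" if "n \<in> NN" for n
    proof -
      have "0 \<le> real n * q" using q by simp
      then have "int m = \<lceil>real n * q\<rceil>" using that by (auto simp: NN_def)
      then show "real n * q \<le> m" "real m - 1 < real n * q" by linarith+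
    qed
    have "j \<le> i + N" if "i \<in> NN" "j \<in> NN" for i j
    proof -
      have "(real j - real i) * q < 1" using ceil(1)[of j] ceil(2)[of i] that by (simp add: algebra_simps)
      then have "real j - real i < 1 / q" using q by (simp add: field_simps)
      then show ?thesis unfolding N_def by linarith
    qed
    then have NN: "finite NN" "card NN \<le> N + 1"
      using finite_nat_card_le_of_diffs[of NN N] by blast+
    have KK: "finite (KK n) \<and> card (KK n) \<le> K + 1" if n: "n \<in> NN" for n
    proof -
      have "real n * q \<le> m" using n by (rule ceil)
      then have "b ^ n \<le> real M powr real m"
        unfolding bpow using M by (intro powr_mono) auto
      then have "b ^ n \<le> real M ^ m" using M by (simp add: powr_realpow)
      then have "b ^ n * h m \<le> real M ^ m * h m" using h M by (intro mult_right_mono) auto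
      also have "\<dots> \<le> 1" using h M by simp
      finally have bh: "b ^ n * h m \<le> 1" .
      have "k' \<le> k + K" if "k \<in> KK n" "k' \<in> KK n" for k k'
      proof -
        obtain y z where y: "y \<in> {0..<1}" "y \<in> {u..u + h m}" "\<kappa> n y = k"
          and z: "z \<in> {0..<1}" "z \<in> {u..u + h m}" "\<kappa> n z = k'"
          using \<open>k \<in> KK n\<close> \<open>k' \<in> KK n\<close> by (auto simp: KK_def)
        have "b ^ n * (z - y) \<le> b ^ n * h m" using y z b by (intro mult_left_mono) auto
        \<comment> \<open>One unit comes from \<open>b ^ n * h m \<le> 1\<close>, the other from the
          difference of two orbit values in \<open>{0..<1}\<close>.\<close>
        then have "digit_value b n z - digit_value b n y \<le> 2"
          using bh beta_map_funpow_bounds[of y n b] beta_map_funpow_bounds[of z n b] y z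
          by (simp add: digit_value_def right_diff_distrib)
        then have "(digit_value b n z - digit_value b n y) / c0 \<le> 2 / c0"
          using c0 by (intro divide_right_mono) auto
        then have "digit_value b n z / c0 \<le> digit_value b n y / c0 + 2 / c0"
          by (simp add: diff_divide_distrib)
        moreover have "0 \<le> digit_value b n z / c0" "0 \<le> digit_value b n y / c0"
          using dv0 y z c0 by auto
        ultimately show ?thesis using y(3) z(3) unfolding \<kappa>_def K_def by linarith
      qed
      then show ?thesis using finite_nat_card_le_of_diffs[of "KK n" K] by blast
    qed
    have sub: "{j. t j = m \<and> B j \<inter> {u..u + h m} \<noteq> {}} \<subseteq> Sigma NN KK"
      by (auto simp: t_def B_def NN_def KK_def)
    have fin: "finite (Sigma NN KK)" using NN KK by auto
    have "card (Sigma NN KK) = (\<Sum>n\<in>NN. card (KK n))"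
      using NN KK by (intro card_SigmaI) auto
    also have "\<dots> \<le> (\<Sum>n\<in>NN. K + 1)" using KK by (intro sum_mono) auto
    also have "\<dots> \<le> (N + 1) * (K + 1)"
      using NN(2) unfolding sum_constant of_nat_id by (rule mult_right_mono) simp
    finally show ?thesis using card_mono[OF fin sub] finite_subset[OF sub fin] by linarith
  qed
  have weight: "l j powr s \<le> \<delta> / D * h m powr s" if "t j = m" for j m
  proof -
    obtain n k where j: "j = (n, k)" by fastforce
    have "real m \<le> real n * q + 1" using that q by (auto simp: j t_def)
    then have "real M powr real m \<le> real M powr (real n * q + 1)"
      using M by (intro powr_mono) auto
    then have "real M ^ m \<le> real M * b ^ n" using M by (simp add: bpow powr_realpow powr_add mult.commute)
    then have "e * h0 * real M ^ m \<le> e * h0 * (real M * b ^ n)"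
      using e h by (intro mult_left_mono) auto
    then have "l j \<le> e * h m" using M b by (simp add: j l_def c_def h(1) field_simps)
    moreover have "0 \<le> l j" using c b by (simp add: j l_def)
    ultimately have "l j powr s \<le> (e * h m) powr s" using s by (intro powr_mono2) auto
    also have "\<dots> = \<delta> / D * h m powr s" unfolding e(2)[symmetric] by (rule powr_mult)
    finally show ?thesis .
  qed
  have "(\<integral>\<^sup>+ j. ennreal (l j powr s) * indicator {j. t j = m \<and> B j \<inter> {u..u + h m} \<noteq> {}} j
      \<partial>count_space UNIV) \<le> ennreal (\<delta> * h m powr s)" for m u
  proof -
    define S where "S = {j. t j = m \<and> B j \<inter> {u..u + h m} \<noteq> {}}"
    have S: "finite S" "card S \<le> (N + 1) * (K + 1)" using count[of m u] by (auto simp: S_def)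
    have "(\<integral>\<^sup>+ j. ennreal (l j powr s) * indicator S j \<partial>count_space UNIV)
        \<le> (\<integral>\<^sup>+ j. ennreal (\<delta> / D * h m powr s) * indicator S j \<partial>count_space UNIV)"
      using weight by (intro nn_integral_mono) (auto split: split_indicator simp: S_def intro!: ennreal_leI)
    also have "\<dots> = ennreal (\<delta> / D * h m powr s) * of_nat (card S)"
      using S by (subst nn_integral_cmult_indicator) (auto simp: emeasure_count_space_finite)
    also have "\<dots> = ennreal (\<delta> / D * h m powr s * real (card S))"
      unfolding ennreal_of_nat_eq_real_of_nat using \<delta> D by (intro ennreal_mult[symmetric]) auto
    also have "\<dots> \<le> ennreal (\<delta> / D * h m powr s * D)"
      using S(2) \<delta> D unfolding D_def
      by (intro ennreal_leI mult_left_mono) (simp_all only: of_nat_le_iff, simp)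
    also have "\<dots> = ennreal (\<delta> * h m powr s)" using D by simp
    finally show ?thesis unfolding S_def .
  qed
  then have "tame_family s h \<delta> B l t"
    using diam c b unfolding tame_family_def by (auto simp: l_def)
  moreover have "\<exists>j. y \<in> B j" if "y \<in> {0..<1}" "\<bar>(beta_map b ^^ n) y - x\<bar> < c" for y n
    using that by (intro exI[of _ "(n, \<kappa> n y)"]) (auto simp: B_def)
  ultimately show thesis using that c by blast
qed

section \<open>Hausdorff dimension\<close>

text \<open>The extra term in \<open>w\<close> makes the length bounds positive for sets of diameter 0.\<close>

lemma tame_family_cover:
  fixes U :: "nat \<Rightarrow> real set"
  assumes U: "\<And>i. bounded (U i)" "(\<Sum>i. ennreal (diameter (U i) powr s)) \<le> ennreal \<epsilon>"
    and s: "0 < s" and \<epsilon>: "0 < \<epsilon>" "2 * \<epsilon> \<le> \<delta> * h 0 powr s" and \<delta>: "0 \<le> \<delta>"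
  obtains l t and B :: "nat \<times> nat \<Rightarrow> real set" where "tame_family s h \<delta> B l t" "\<And>i. U i = B (i, 0)"
proof -
  define w where "w i = diameter (U i) powr s + \<epsilon> * (1 / 2) ^ Suc i" for i
  have wpos: "0 < w i" for i using \<epsilon> by (simp add: w_def add_nonneg_pos)
  define l where "l = (\<lambda>(i::nat, k::nat). w i powr (1 / s))"
  \<comment> \<open>The dummy index \<open>k\<close> gives the cover the index type of the hole
    families, so that they can be combined; the added obstacles are empty.\<close>
  define B where "B = (\<lambda>(i, k::nat). if k = 0 then U i else {})"
  have ls: "l (i, k) powr s = w i" for i k
    using wpos[of i] s by (simp add: l_def powr_powr)
  have "\<bar>a - b\<bar> \<le> l (i, k)" if "a \<in> B (i, k)" "b \<in> B (i, k)" for a b i k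
  proof -
    have "a \<in> U i" "b \<in> U i" using that by (auto simp: B_def split: if_splits)
    then have d: "\<bar>a - b\<bar> \<le> diameter (U i)"
      using diameter_bounded_bound[OF U(1)] by (simp add: dist_real_def)
    then have "\<bar>a - b\<bar> powr s \<le> diameter (U i) powr s" using s by (intro powr_mono2) auto
    also have "\<dots> \<le> l (i, k) powr s" unfolding ls w_def using \<epsilon> by simp
    finally show ?thesis
      using s powr_less_mono2[of s "l (i, k)" "\<bar>a - b\<bar>"] wpos[of i]
      by (force simp: l_def not_less[symmetric])
  qed
  moreover have "0 < l j" for j using wpos[of "fst j"] by (simp add: l_def case_prod_beta)
  \<comment> \<open>All covering sets enter at stage 0. Their total weight there is at most
    \<open>2 * \<epsilon>\<close>, wherever the interval lies.\<close>
  moreover have "(\<integral>\<^sup>+ j. ennreal (l j powr s) * indicator {j. 0 = m \<and> B j \<inter> {u..u + h m} \<noteq> {}} j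
      \<partial>count_space UNIV) \<le> ennreal (\<delta> * h m powr s)" for m :: nat and u
  proof (cases "m = 0")
    case True
    have "(\<integral>\<^sup>+ j. ennreal (l j powr s) * indicator {j. 0 = m \<and> B j \<inter> {u..u + h m} \<noteq> {}} j \<partial>count_space UNIV)
        \<le> (\<integral>\<^sup>+ j. (case j of (i, k) \<Rightarrow> ennreal (w i) * indicator {0::nat} k) \<partial>count_space UNIV)"
      by (intro nn_integral_mono) (auto split: split_indicator if_splits simp: B_def ls)
    also have "\<dots> = (\<integral>\<^sup>+ i. \<integral>\<^sup>+ k. ennreal (w i) * indicator {0::nat} k \<partial>count_space UNIV \<partial>count_space UNIV)"
      by (simp add: nn_integral_fst_count_space[symmetric])
    also have "\<dots> = (\<integral>\<^sup>+ i. ennreal (w i) \<partial>count_space UNIV)"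
      by (intro nn_integral_cong) (subst nn_integral_cmult_indicator, auto)
    also have "\<dots> = (\<Sum>i. ennreal (diameter (U i) powr s) + ennreal (\<epsilon> * (1 / 2) ^ Suc i))"
      using \<epsilon> by (simp add: nn_integral_count_space_nat w_def)
    also have "\<dots> = (\<Sum>i. ennreal (diameter (U i) powr s)) + (\<Sum>i. ennreal (\<epsilon> * (1 / 2) ^ Suc i))"
      by (intro suminf_add[symmetric]) auto
    also have "(\<Sum>i. ennreal (\<epsilon> * (1 / 2) ^ Suc i)) = ennreal \<epsilon>"
      using sums_mult[OF power_half_series, of \<epsilon>] \<epsilon> by (intro suminf_ennreal_eq) auto
    also have "(\<Sum>i. ennreal (diameter (U i) powr s)) + ennreal \<epsilon> \<le> ennreal \<epsilon> + ennreal \<epsilon>"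
      using U(2) by (intro add_right_mono)
    also have "\<dots> = ennreal (2 * \<epsilon>)" using \<epsilon> by (simp add: ennreal_plus[symmetric])
    also have "\<dots> \<le> ennreal (\<delta> * h m powr s)" using \<epsilon> True by (intro ennreal_leI) simp
    finally show ?thesis .
  qed simp
  ultimately have "tame_family s h \<delta> B l (\<lambda>_. 0)" unfolding tame_family_def by auto
  then show thesis by (rule that) (simp add: B_def)
qed

text \<open>The cover joins the hole families as one more tame family; a point avoiding them all
  lies in every \<open>G\<close> but in no \<open>U i\<close>. The bound \<open>\<epsilon>\<close>
  is fixed before \<open>U\<close>, as the passage to Hausdorff measure requires.\<close>

lemma orbit_avoiding_set_not_covered:
  fixes \<beta> x :: "nat \<Rightarrow> real"
  assumes \<beta>: "\<And>i. 1 < \<beta> i" and terminates: "\<And>i. beta_expansion_of_1_terminates (\<beta> i)"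
    and s: "0 < s" "s < 1"
  shows "\<exists>\<epsilon>>0. \<forall>U. (\<forall>i. bounded (U i)) \<longrightarrow> (\<Sum>i. ennreal (diameter (U i) powr s)) \<le> ennreal \<epsilon> \<longrightarrow>
       \<not> (\<Inter>i. G (beta_map (\<beta> i)) (x i)) \<subseteq> (\<Union>i::nat. U i)"
proof -
  \<comment> \<open>Since \<open>s < 1\<close>, a large \<open>M\<close> satisfies
    \<open>real M powr (1 - s) \<ge> 4\<close>, the room needed by the descent.\<close>
  obtain M :: nat where M': "max 2 (4 powr (1 / (1 - s))) \<le> real M" using real_arch_simple by blast
  then have M: "1 < M" by simp
  have "4 = (4 powr (1 / (1 - s))) powr (1 - s)" using s by (simp add: powr_powr)
  also have "\<dots> \<le> real M powr (1 - s)" using M' s by (intro powr_mono2) auto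
  finally have "4 * real M powr s \<le> real M powr (1 - s) * real M powr s"
    by (intro mult_right_mono) auto
  then have M4: "4 * real M powr s \<le> real M" using M by (simp add: powr_add[symmetric])
  define \<delta> where "\<delta> = real M powr (-s) / 4"
  have \<delta>: "0 < \<delta>" using M by (simp add: \<delta>_def)
  \<comment> \<open>The initial length 1/2 keeps the point below 1, as membership in
    \<open>G\<close> demands.\<close>
  define h where "h m = (1 / 2) / real M ^ m" for m
  \<comment> \<open>Share 0 of the budget goes to the cover, share \<open>Suc i\<close> to the holes
    of \<open>\<beta> i\<close>.\<close>
  define \<delta>s where "\<delta>s i = \<delta> * (1 / 2) ^ Suc i" for i
  have \<delta>s: "0 < \<delta>s i" for i using \<delta> by (simp add: \<delta>s_def)
  have sums: "\<delta>s sums \<delta>" unfolding \<delta>s_def using sums_mult[OF power_half_series, of \<delta>] by simp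
  \<comment> \<open>Halved because enlarging the lengths of the covering sets adds another
    \<open>\<epsilon>\<close> to their weight.\<close>
  define \<epsilon> where "\<epsilon> = \<delta>s 0 * h 0 powr s / 2"
  have \<epsilon>: "0 < \<epsilon>" using \<delta>s by (simp add: \<epsilon>_def h_def)
  have "\<exists>c l t (B :: nat \<times> nat \<Rightarrow> real set). 0 < c \<and> tame_family s h (\<delta>s (Suc i)) B l t \<and>
      (\<forall>y n. y \<in> {0..<1} \<longrightarrow> \<bar>(beta_map (\<beta> i) ^^ n) y - x i\<bar> < c \<longrightarrow> (\<exists>j. y \<in> B j))" for i
  proof -
    obtain c l t and B :: "nat \<times> nat \<Rightarrow> real set"
      where "0 < c" "tame_family s h (\<delta>s (Suc i)) B l t"
        "\<And>y n. y \<in> {0..<1} \<Longrightarrow> \<bar>(beta_map (\<beta> i) ^^ n) y - x i\<bar> < c \<Longrightarrow> \<exists>j. y \<in> B j"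
      by (rule tame_family_beta[OF \<beta>[of i] terminates[of i] s(1) M h_def, of "\<delta>s (Suc i)" "x i"])
        (use \<delta>s in auto)
    then show ?thesis by blast
  qed
  then obtain c l t and B :: "nat \<Rightarrow> nat \<times> nat \<Rightarrow> real set" where c: "\<And>i. 0 < c i"
      and tame: "\<And>i. tame_family s h (\<delta>s (Suc i)) (B i) (l i) (t i)"
      and B: "\<And>i y n. y \<in> {0..<1} \<Longrightarrow> \<bar>(beta_map (\<beta> i) ^^ n) y - x i\<bar> < c i \<Longrightarrow> \<exists>j. y \<in> B i j"
    by metis
  have "\<not> (\<Inter>i. G (beta_map (\<beta> i)) (x i)) \<subseteq> (\<Union>i. U i)"
    if U: "\<And>i. bounded (U i)" "(\<Sum>i. ennreal (diameter (U i) powr s)) \<le> ennreal \<epsilon>" for U :: "nat \<Rightarrow> real set"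
  proof -
    obtain l' t' and B' :: "nat \<times> nat \<Rightarrow> real set"
      where tame': "tame_family s h (\<delta>s 0) B' l' t'" and B': "\<And>i. U i = B' (i, 0)"
      using \<delta>s[of 0] by (rule_tac tame_family_cover[OF U s(1) \<epsilon>, of "\<delta>s 0" h]) (auto simp: \<epsilon>_def)
    have "tame_family s h (\<delta>s i) (case_nat B' B i) (case_nat l' l i) (case_nat t' t i)" for i
      using tame tame' by (cases i) auto
    then have all: "tame_family s h \<delta> (\<lambda>(i, j). case_nat B' B i j)
        (\<lambda>(i, j). case_nat l' l i j) (\<lambda>(i, j). case_nat t' t i j)"
      using \<delta>s sums by (intro tame_family_combine) (auto intro: less_imp_le)
    obtain y where y: "y \<in> {0..1 / 2}" "\<And>j. y \<notin> (case j of (i, j) \<Rightarrow> case_nat B' B i j)"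
      by (rule tame_family_avoidance[OF all s(1) M M4 h_def]) (auto simp: \<delta>_def)
    have "y \<notin> U i" for i using y(2)[of "(0, (i, 0))"] B' by simp
    moreover have "y \<in> G (beta_map (\<beta> i)) (x i)" for i
    proof -
      have y01: "y \<in> {0..<1}" using y(1) by auto
      have "y \<notin> B i j" for j using y(2)[of "(Suc i, j)"] by simp
      then have far: "c i \<le> \<bar>(beta_map (\<beta> i) ^^ n) y - x i\<bar>" for n
        using B[OF y01, where i = i and n = n] by (meson not_less)
      have "x i \<notin> closure (\<Union>n. {(beta_map (\<beta> i) ^^ n) y})"
        using c[of i] far by (auto simp: closure_approachable dist_real_def not_less)
      then show ?thesis using y01 by (simp add: G_def)
    qed
    ultimately show ?thesis by blast
  qed
  then show ?thesis using \<epsilon> by blast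
qed

lemma hausdorff_measure_eq_0_imp_cover:
  assumes "hausdorff_measure s A = 0" "0 < \<delta>" "0 < \<epsilon>"
  obtains U where "A \<subseteq> (\<Union>i. U i)" "\<And>i. bounded (U i)" "\<And>i. diameter (U i) \<le> \<delta>"
    "(\<Sum>i. hausdorff_weight s (U i)) < \<epsilon>"
proof -
  have "hausdorff_premeasure s \<delta> A \<le> hausdorff_measure s A"
    unfolding hausdorff_measure_def using assms by (intro SUP_upper) auto
  then have "hausdorff_premeasure s \<delta> A < \<epsilon>" using assms by simp
  then show thesis unfolding hausdorff_premeasure_def INF_less_iff using that by auto
qed

text \<open>Covering by \<open>N\<close> intervals of length \<open>1 / N\<close> gives total weight
  at most \<open>N powr (1 - s)\<close>, which tends to 0.\<close>

lemma hausdorff_measure_eq_0_of_subset_unit_interval: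
  fixes A :: "real set"
  assumes A: "A \<subseteq> {0..1}" and s: "1 < s"
  shows "hausdorff_measure s A = 0"
proof -
  have "hausdorff_premeasure s \<delta> A \<le> 0" if \<delta>: "0 < \<delta>" for \<delta>
  proof (rule tendsto_lowerbound)
    have "(\<lambda>n. real (Suc n) powr (1 - s)) \<longlonglongrightarrow> 0"
      using s filterlim_compose[OF filterlim_real_sequentially filterlim_Suc]
      by (intro tendsto_neg_powr) auto
    then show "(\<lambda>n. ennreal (real (Suc n) powr (1 - s))) \<longlonglongrightarrow> 0"
      using tendsto_ennrealI by fastforce
    have "\<forall>\<^sub>F n in sequentially. inverse (real (Suc n)) < \<delta>"
      using LIMSEQ_inverse_real_of_nat \<delta> by (rule order_tendstoD)
    then show "\<forall>\<^sub>F n in sequentially. hausdorff_premeasure s \<delta> A \<le> ennreal (real (Suc n) powr (1 - s))"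
    proof eventually_elim
      case (elim n)
      define N where "N = real (Suc n)"
      have N: "0 < N" "1 / N < \<delta>" using elim by (simp_all add: N_def inverse_eq_divide)
      define U where "U i = (if i \<le> n then {real i / N..real (Suc i) / N} else {})" for i
      have diam: "diameter (U i) = 1 / N" if "i \<le> n" for i
        using that N by (simp add: U_def diff_divide_distrib[symmetric] divide_right_mono not_less)
      have "y \<in> (\<Union>i. U i)" if "y \<in> A" for y
      proof -
        have y: "0 \<le> y" "y \<le> 1" using that A by auto
        define k where "k = nat \<lfloor>y * N\<rfloor>"
        have k: "real k \<le> y * N" "y * N \<le> real k + 1" using y N by (auto simp: k_def)
        show ?thesis
        proof (cases "k \<le> n")
          case True
          then have "y \<in> U k" using k N by (simp add: U_def field_simps)
          then show ?thesis by blast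
        next
          \<comment> \<open>Only the endpoint \<open>y = 1\<close> falls past the last index; the
            last closed interval contains it.\<close>
          case False
          then have "N \<le> real k" by (simp add: N_def)
          then have "N * 1 \<le> N * y" using k by (simp add: mult.commute)
          then have "y = 1" using y N by simp
          then have "y \<in> U n" using N by (simp add: U_def N_def)
          then show ?thesis by blast
        qed
      qed
      moreover have "bounded (U i)" for i by (simp add: U_def)
      moreover have "diameter (U i) \<le> \<delta>" for i
        using diam[of i] N \<delta> by (cases "i \<le> n") (auto simp: U_def)
      ultimately have "hausdorff_premeasure s \<delta> A \<le> (\<Sum>i. hausdorff_weight s (U i))"
        unfolding hausdorff_premeasure_def by (intro INF_lower) auto
      also have "\<dots> = (\<Sum>i\<in>{..n}. hausdorff_weight s (U i))"
        by (intro suminf_finite) (auto simp: U_def hausdorff_weight_def)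
      also have "\<dots> \<le> (\<Sum>i\<in>{..n}. ennreal ((1 / N) powr s))"
        using diam by (intro sum_mono) (use s in \<open>auto simp: hausdorff_weight_def\<close>)
      also have "\<dots> = ennreal (N * (1 / N) powr s)"
        by (simp add: N_def ennreal_mult ennreal_of_nat_eq_real_of_nat)
      also have "N * (1 / N) powr s = N powr (1 - s)"
        using N by (simp add: powr_divide powr_diff)
      finally show ?case by (simp add: N_def)
    qed
  qed simp
  then show ?thesis unfolding hausdorff_measure_def by (auto simp: SUP_eq_iff intro!: antisym SUP_least)
qed

theorem corollary1p6:
  fixes \<beta> x :: "nat \<Rightarrow> real"
  assumes "\<And>i. \<beta> i \<in> {1<..<2}"
    and "\<And>i. beta_expansion_of_1_terminates (\<beta> i)"
    and "\<And>i. x i \<in> {0..1}"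
  shows "hausdorff_dim (\<Inter>i. G (beta_map (\<beta> i)) (x i)) = 1"
proof (rule antisym)
  let ?A = "\<Inter>i. G (beta_map (\<beta> i)) (x i)"
  have "?A \<subseteq> {0..1}" by (auto simp: G_def)
  then have le: "hausdorff_dim ?A \<le> ennreal s" if "1 < s" for s
    unfolding hausdorff_dim_def using that hausdorff_measure_eq_0_of_subset_unit_interval[of ?A s]
    by (intro INF_lower) simp
  show "hausdorff_dim ?A \<le> 1"
  proof (rule ennreal_le_epsilon)
    fix e :: real assume "0 < e"
    then show "hausdorff_dim ?A \<le> 1 + ennreal e" using le[of "1 + e"] by simp
  qed
  have \<beta>1: "1 < \<beta> i" for i using assms(1)[of i] by simp
  show "1 \<le> hausdorff_dim ?A"
    unfolding hausdorff_dim_def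
  proof (rule INF_greatest, rule ccontr)
    fix s assume "s \<in> {s. 0 \<le> s \<and> hausdorff_measure s ?A = 0}" "\<not> 1 \<le> ennreal s"
    then have s: "0 \<le> s" "s < 1" "hausdorff_measure s ?A = 0" by (auto simp: not_le)
    \<comment> \<open>Passing to \<open>r > 0\<close> also covers \<open>s = 0\<close>, where the weight of a nonempty set is 1.\<close>
    define r where "r = (s + 1) / 2"
    have r: "0 < r" "r < 1" "s \<le> r" using s by (auto simp: r_def)
    obtain \<epsilon> where \<epsilon>: "0 < \<epsilon>"
      "\<forall>U. (\<forall>i. bounded (U i)) \<longrightarrow> (\<Sum>i. ennreal (diameter (U i) powr r)) \<le> ennreal \<epsilon> \<longrightarrow>
         \<not> ?A \<subseteq> (\<Union>i::nat. U i)"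
      using orbit_avoiding_set_not_covered[where \<beta> = \<beta> and x = x, OF \<beta>1 assms(2) r(1,2)]
      by blast
    obtain U where U: "?A \<subseteq> (\<Union>i. U i)" "\<And>i. bounded (U i)" "\<And>i. diameter (U i) \<le> 1"
        "(\<Sum>i. hausdorff_weight s (U i)) < ennreal \<epsilon>"
      by (rule hausdorff_measure_eq_0_imp_cover[OF s(3), of 1 "ennreal \<epsilon>"]) (use \<epsilon>(1) in simp_all)
    \<comment> \<open>For diameters at most 1 the power decreases as the exponent grows. For
      \<open>s = 0\<close> a nonempty set has weight 1, which dominates; for the empty set both
      sides are 0.\<close>
    have "ennreal (diameter (U i) powr r) \<le> hausdorff_weight s (U i)" for i
    proof -
      have d: "0 \<le> diameter (U i)" using U(2) by (rule diameter_ge_0)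
      have "diameter (U i) powr r \<le> diameter (U i) powr s" using r d U(3) by (intro powr_mono') auto
      moreover have "diameter (U i) powr r \<le> 1" using r d U(3) by (intro powr_le1) auto
      ultimately show ?thesis using r by (auto simp: hausdorff_weight_def intro: ennreal_leI)
    qed
    then have "(\<Sum>i. ennreal (diameter (U i) powr r)) \<le> (\<Sum>i. hausdorff_weight s (U i))"
      by (intro suminf_le) auto
    also have "\<dots> \<le> ennreal \<epsilon>" using U(4) by simp
    finally show False using \<epsilon>(2) U(1,2) by blast
  qed
qed

end
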